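(* Consider Case 4 of the problem described in the context (density $\rho$ unknown; $k,c,\ell>0$, $T_m$, $T_0>T_m$, $q_0>0$ given), whose solution for $0<\alpha<1$ and any data is $\rho_\alpha=\frac{q_0^2\Gamma^2(1-\frac{\alpha}{2})}{kc(T_0-T_m)^2}[1-W(-\xi_\alpha;-\frac{\alpha}{2},1)]^2$, $T_\alpha(x,t)=T_0-\frac{T_0-T_m}{1-W(-\xi_\alpha;-\frac{\alpha}{2},1)}[1-W(-\frac{x}{\lambda_\alpha t^{\alpha/2}};-\frac{\alpha}{2},1)]$, $s_\alpha(t)=\lambda_\alpha\xi_\alpha t^{\alpha/2}$, $\lambda_\alpha=\frac{k(T_0-T_m)}{q_0\Gamma(1-\frac{\alpha}{2})[1-W(-\xi_\alpha;-\frac{\alpha}{2},1)]}$, with $\xi_\alpha>0$ the unique solution of $\frac{x[1-W(-x;-\frac{\alpha}{2},1)]}{M_{\alpha/2}(x)}=\frac{c(T_0-T_m)\Gamma(1-\frac{\alpha}{2})}{\ell\Gamma(1+\frac{\alpha}{2})}$, $x>0$. Then, for any data, as $\alpha\to1^-$ this solution coincides with the following one (the classical case $\alpha=1$): $$s_1(t)=2\lambda_1\mu_1t^{1/2},\quad T_1(x,t)=T_0-\frac{T_0-T_m}{\operatorname{erf}(\mu_1)}\operatorname{erf}\left(\frac{x}{2\lambda_1t^{1/2}}\right),$$ $$\rho_1=\frac{\pi q_0^2}{kc(T_0-T_m)^2}\operatorname{erf}^2(\mu_1),\quad \lambda_1=\frac{k(T_0-T_m)}{q_0\sqrt{\pi}\,\operatorname{erf}(\mu_1)},$$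 where $\mu_1>0$ is the unique solution of $$x\exp(x^2)\operatorname{erf}(x)=\frac{c(T_0-T_m)}{\ell\sqrt{\pi}},\quad x>0.$$
   Context: For $0<\alpha<1$ the Caputo derivative is $D^\alpha f(t)=\frac{1}{\Gamma(1-\alpha)}\int_0^t \frac{f'(\tau)}{(t-\tau)^\alpha}d\tau$, and $D^1f=f'$. The Wright function is $W(z;a,b)=\sum_{n\ge0}\frac{z^n}{n!\,\Gamma(na+b)}$ ($a>-1$, $b\in\mathbb{R}$); the Mainardi function is $M_\nu(z)=W(-z;-\nu,1-\nu)$. $\operatorname{erf}(x)=\frac{2}{\sqrt\pi}\int_0^x e^{-u^2}du$. The problem (for $0<\alpha\le 1$): with positive constants $\rho,k,c,\ell$, $\lambda^2=k/(\rho c)$, melting temperature $T_m$, $T_0>T_m$, $q_0>0$, find $s(t)$, $T(x,t)$ and the unknown coefficient with $D^\alpha T=\lambda^2T_{xx}$ in $0<x<s(t)$, $t>0$; $s(0)=0$; $T(x,0)=T(+\infty,t)=T_m$; $T(s(t),t)=T_m$; $-kT_x(s(t),t)=\rho\ell D^\alpha s(t)$; $T(0,t)=T_0$; $kT_x(0,t)=-q_0/t^{\alpha/2}$ for $t>0$. *)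

theory Defs
  imports "HOL-Analysis.Analysis"
begin

text \<open>Wright function W(z;a,b) = sum_n z^n / (n! Gamma(n a + b)), with 1/Gamma = rGamma
  (entire, vanishing at the poles of Gamma).\<close>
definition Wright :: "real \<Rightarrow> real \<Rightarrow> real \<Rightarrow> real" where
  "Wright z a b = (\<Sum>n. z ^ n * rGamma (real n * a + b) / fact n)"

definition Mainardi :: "real \<Rightarrow> real \<Rightarrow> real" where
  "Mainardi \<nu> z = Wright (- z) (- \<nu>) (1 - \<nu>)"

definition erf :: "real \<Rightarrow> real" where
  "erf x = 2 / sqrt pi *
     (if 0 \<le> x then integral {0..x} (\<lambda>u. exp (- u\<^sup>2)) else - integral {x..0} (\<lambda>u. exp (- u\<^sup>2)))"

definition xi4 :: "real \<Rightarrow> real \<Rightarrow> real \<Rightarrow> real \<Rightarrow> real \<Rightarrow> real" where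
  "xi4 c l T0 Tm \<alpha> = (THE x. 0 < x \<and>
     x * (1 - Wright (- x) (- \<alpha> / 2) 1) / Mainardi (\<alpha> / 2) x
       = c * (T0 - Tm) * Gamma (1 - \<alpha> / 2) / (l * Gamma (1 + \<alpha> / 2)))"

definition lam4 :: "real \<Rightarrow> real \<Rightarrow> real \<Rightarrow> real \<Rightarrow> real \<Rightarrow> real \<Rightarrow> real \<Rightarrow> real" where
  "lam4 k c l T0 Tm q0 \<alpha> = k * (T0 - Tm) /
     (q0 * Gamma (1 - \<alpha> / 2) * (1 - Wright (- xi4 c l T0 Tm \<alpha>) (- \<alpha> / 2) 1))"

definition rho4 :: "real \<Rightarrow> real \<Rightarrow> real \<Rightarrow> real \<Rightarrow> real \<Rightarrow> real \<Rightarrow> real \<Rightarrow> real" where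
  "rho4 k c l T0 Tm q0 \<alpha> = q0\<^sup>2 * (Gamma (1 - \<alpha> / 2))\<^sup>2 / (k * c * (T0 - Tm)\<^sup>2) *
     (1 - Wright (- xi4 c l T0 Tm \<alpha>) (- \<alpha> / 2) 1)\<^sup>2"

definition s4 :: "real \<Rightarrow> real \<Rightarrow> real \<Rightarrow> real \<Rightarrow> real \<Rightarrow> real \<Rightarrow> real \<Rightarrow> real \<Rightarrow> real" where
  "s4 k c l T0 Tm q0 \<alpha> t = lam4 k c l T0 Tm q0 \<alpha> * xi4 c l T0 Tm \<alpha> * t powr (\<alpha> / 2)"

definition T4 :: "real \<Rightarrow> real \<Rightarrow> real \<Rightarrow> real \<Rightarrow> real \<Rightarrow> real \<Rightarrow> real \<Rightarrow> real \<Rightarrow> real \<Rightarrow> real" where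
  "T4 k c l T0 Tm q0 \<alpha> x t = T0 - (T0 - Tm) / (1 - Wright (- xi4 c l T0 Tm \<alpha>) (- \<alpha> / 2) 1) *
     (1 - Wright (- (x / (lam4 k c l T0 Tm q0 \<alpha> * t powr (\<alpha> / 2)))) (- \<alpha> / 2) 1)"

definition mu4 :: "real \<Rightarrow> real \<Rightarrow> real \<Rightarrow> real \<Rightarrow> real" where
  "mu4 c l T0 Tm = (THE x. 0 < x \<and> x * exp (x\<^sup>2) * erf x = c * (T0 - Tm) / (l * sqrt pi))"

definition lam4_1 :: "real \<Rightarrow> real \<Rightarrow> real \<Rightarrow> real \<Rightarrow> real \<Rightarrow> real \<Rightarrow> real" where
  "lam4_1 k c l T0 Tm q0 = k * (T0 - Tm) / (q0 * sqrt pi * erf (mu4 c l T0 Tm))"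

definition rho4_1 :: "real \<Rightarrow> real \<Rightarrow> real \<Rightarrow> real \<Rightarrow> real \<Rightarrow> real \<Rightarrow> real" where
  "rho4_1 k c l T0 Tm q0 = pi * q0\<^sup>2 / (k * c * (T0 - Tm)\<^sup>2) * (erf (mu4 c l T0 Tm))\<^sup>2"

definition s4_1 :: "real \<Rightarrow> real \<Rightarrow> real \<Rightarrow> real \<Rightarrow> real \<Rightarrow> real \<Rightarrow> real \<Rightarrow> real" where
  "s4_1 k c l T0 Tm q0 t = 2 * lam4_1 k c l T0 Tm q0 * mu4 c l T0 Tm * sqrt t"

definition T4_1 :: "real \<Rightarrow> real \<Rightarrow> real \<Rightarrow> real \<Rightarrow> real \<Rightarrow> real \<Rightarrow> real \<Rightarrow> real \<Rightarrow> real" where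
  "T4_1 k c l T0 Tm q0 x t = T0 - (T0 - Tm) / erf (mu4 c l T0 Tm) *
     erf (x / (2 * lam4_1 k c l T0 Tm q0 * sqrt t))"

end

theory Submission
  imports Defs "HOL-Real_Asymp.Real_Asymp"
begin

text \<open>
  Put \<open>\<nu> = \<alpha> / 2\<close>. The Wright function is jointly continuous up to \<open>\<nu> = 1/2\<close>, where its
  three-term recurrence becomes the differential equation \<open>M' = - x M / 2\<close> of the Gaussian; so
  everything reduces to showing that the root \<open>\<xi>\<close> exists, is unique and converges to \<open>2 \<mu>\<close>. On a
  fixed interval \<open>[0, R]\<close> the ratio defining \<open>\<xi>\<close> is strictly increasing for \<open>\<nu>\<close> near \<open>1/2\<close>,
  because \<open>M\<close> and \<open>M'\<close> are uniformly close to their Gaussian limits. Beyond \<open>R\<close> no monotonicity (nor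
  positivity of \<open>M\<close>) is needed: the reflection formula for \<open>\<Gamma>\<close> turns the Wright series into an
  absolutely convergent integral with an oscillating factor of modulus at most 1, the recurrence
  then gives \<open>\<bar>M x\<bar> \<le> 11 / x\<^sup>2\<close> uniformly in \<open>\<nu>\<close>, and so the ratio is either nonpositive or too large.
\<close>

section \<open>Reflection formula and growth of the Gamma function\<close>

lemma rGamma_reflection_real:
  "rGamma (z::real) * rGamma (1 - z) = sin (pi * z) / pi"
proof -
  have "complex_of_real (rGamma z * rGamma (1 - z)) = complex_of_real (sin (pi * z) / pi)"
    using rGamma_reflection_complex[of "of_real z"]
    by (simp flip: rGamma_complex_of_real sin_of_real)
  then show ?thesis
    by (simp only: of_real_eq_iff)
qed

text \<open>Trades a reciprocal Gamma value, possibly far on the negative axis, for Gamma at a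
  positive argument times a sine. That sine is the oscillating factor of the Wright series.\<close>

lemma rGamma_eq_Gamma_sin:
  fixes z :: real
  assumes "z < 1"
  shows "rGamma z = Gamma (1 - z) * sin (pi * z) / pi"
proof -
  have "Gamma (1 - z) \<noteq> 0"
    using assms by (metis Gamma_real_pos diff_gt_0_iff_gt less_irrefl)
  then show ?thesis
    using rGamma_reflection_real[of z] unfolding rGamma_inverse_Gamma[of "1 - z"]
    by (simp add: field_simps)
qed

lemma abs_rGamma_le_Gamma:
  fixes z :: real
  assumes "z < 1"
  shows "\<bar>rGamma z\<bar> \<le> Gamma (1 - z)"
proof -
  have G: "0 < Gamma (1 - z)"
    using assms by (intro Gamma_real_pos) auto
  have "\<bar>rGamma z\<bar> = Gamma (1 - z) * (\<bar>sin (pi * z)\<bar> / pi)"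
    using G by (simp add: rGamma_eq_Gamma_sin[OF assms] abs_mult)
  also have "\<dots> \<le> Gamma (1 - z) * 1"
  proof (rule mult_left_mono)
    show "\<bar>sin (pi * z)\<bar> / pi \<le> 1"
      using order_trans[OF abs_sin_le_one[of "pi * z"], of pi] pi_gt3 by simp
  qed (use G in simp)
  finally show ?thesis by simp
qed

text \<open>Log-convexity of Gamma with weight 1/2.\<close>

lemma Gamma_midpoint_le:
  fixes a b :: real
  assumes "0 < a" "0 < b"
  shows "Gamma ((a + b) / 2) \<le> sqrt (Gamma a * Gamma b)"
proof -
  have pos: "0 < Gamma a" "0 < Gamma b" "0 < Gamma ((a + b) / 2)"
    using assms by (auto intro!: Gamma_real_pos)
  have "ln (Gamma ((1 - 1/2) *\<^sub>R a + (1/2) *\<^sub>R b)) \<le> (1 - 1/2) * ln (Gamma a) + (1/2) * ln (Gamma b)"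
    using convex_onD[OF log_convex_Gamma_real, of "1/2" a b] assms by auto
  moreover have "(1 - 1/2) *\<^sub>R a + (1/2) *\<^sub>R b = (a + b) / 2"
    by (simp add: field_simps)
  ultimately have "ln (Gamma ((a + b) / 2)) \<le> (1 - 1/2) * ln (Gamma a) + (1/2) * ln (Gamma b)"
    by (simp only:)
  also have "\<dots> = ln (sqrt (Gamma a * Gamma b))"
    using pos by (simp add: ln_sqrt ln_mult add_divide_distrib)
  finally have "ln (Gamma ((a + b) / 2)) \<le> ln (sqrt (Gamma a * Gamma b))" .
  then show ?thesis
    using pos by (subst (asm) ln_le_cancel_iff) auto
qed

text \<open>Common majorant of the Wright series: the square root leaves about half a factorial in
  the denominator, so the ratio of consecutive terms tends to 0.\<close>

lemma summable_power_sqrt_fact: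
  "summable (\<lambda>n. R ^ n * sqrt (fact (n + K)) / fact n :: real)"
proof -
  have "(\<lambda>n. \<bar>R\<bar> * sqrt (real n + real K + 1) / (real n + 1)) \<longlonglongrightarrow> 0"
    by real_asymp
  then have "\<forall>\<^sub>F n in sequentially. \<bar>R\<bar> * sqrt (real n + real K + 1) / (real n + 1) < 1/2"
    by (rule order_tendstoD) auto
  then obtain N where N: "\<And>n. n \<ge> N \<Longrightarrow> \<bar>R\<bar> * sqrt (real n + real K + 1) / (real n + 1) < 1/2"
    by (auto simp: eventually_sequentially)
  show ?thesis
  proof (rule summable_ratio_test[of "1/2" N])
    fix n assume n: "n \<ge> N"
    have "sqrt (fact (Suc n + K)) = sqrt (real n + real K + 1) * sqrt (fact (n + K) :: real)"
      by (simp add: real_sqrt_mult[symmetric] algebra_simps)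
    then have "norm (R ^ Suc n * sqrt (fact (Suc n + K)) / fact (Suc n) :: real)
        = (\<bar>R\<bar> * sqrt (real n + real K + 1) / (real n + 1)) * norm (R ^ n * sqrt (fact (n + K)) / fact n :: real)"
      by (simp add: abs_mult power_abs field_simps del: fact_Suc) (simp add: field_simps)
    also have "\<dots> \<le> 1/2 * norm (R ^ n * sqrt (fact (n + K)) / fact n :: real)"
      by (intro mult_right_mono less_imp_le[OF N[OF n]]) auto
    finally show "norm (R ^ Suc n * sqrt (fact (Suc n + K)) / fact (Suc n) :: real)
        \<le> 1/2 * norm (R ^ n * sqrt (fact (n + K)) / fact n :: real)" .
  qed auto
qed

text \<open>As \<nu> \<le> 1/2, the argument lies below the midpoint of 1 and
  \<open>n + K + 1\<close>, where the midpoint inequality bounds Gamma by the root of a factorial.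
  The lower bound \<open>a\<close> makes the threshold for \<open>n\<close> uniform in \<nu>;
  arguments from 2 on lie where Gamma increases.\<close>

lemma Gamma_linear_bound:
  assumes "0 < a"
  shows "\<forall>\<^sub>F n in sequentially. \<forall>\<nu>\<in>{a..1/2}. \<forall>d. \<bar>d\<bar> \<le> B \<longrightarrow>
    2 \<le> \<nu> * real n + d \<and> Gamma (\<nu> * real n + d) \<le> sqrt (fact (n + nat \<lceil>2 * B + 2\<rceil>))"
proof -
  define K where "K = nat \<lceil>2 * B + 2\<rceil>"
  have "filterlim (\<lambda>n. a * real n - B) at_top sequentially"
    using assms by real_asymp
  then have "\<forall>\<^sub>F n in sequentially. 2 \<le> a * real n - B"
    by (simp add: filterlim_at_top)
  then show ?thesis
  proof (eventually_elim, intro ballI allI impI)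
    fix n \<nu> d assume n: "2 \<le> a * real n - B" and \<nu>: "\<nu> \<in> {a..1/2}" and d: "\<bar>d\<bar> \<le> B"
    have "a * real n \<le> \<nu> * real n" "\<nu> * real n \<le> 1/2 * real n"
      using \<nu> by (intro mult_right_mono; simp)+
    moreover have K: "2 * B + 2 \<le> real K"
      unfolding K_def by linarith
    ultimately have ge: "2 \<le> \<nu> * real n + d" and le: "\<nu> * real n + d \<le> (1 + (real (n + K) + 1)) / 2"
      using n d by auto
    have "Gamma (\<nu> * real n + d) \<le> Gamma ((1 + (real (n + K) + 1)) / 2)"
      using Gamma_real_strict_mono[of "\<nu> * real n + d" "(1 + (real (n + K) + 1)) / 2"] ge le
      by (cases "\<nu> * real n + d = (1 + (real (n + K) + 1)) / 2") (simp_all only: order_refl, force)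
    also have "\<dots> \<le> sqrt (Gamma 1 * Gamma (real (n + K) + 1))"
      by (rule Gamma_midpoint_le) auto
    also have "\<dots> = sqrt (fact (n + K))"
      using Gamma_fact[of "n + K", where 'a = real] by (simp add: add_ac)
    finally show "2 \<le> \<nu> * real n + d \<and> Gamma (\<nu> * real n + d) \<le> sqrt (fact (n + nat \<lceil>2 * B + 2\<rceil>))"
      using ge by (simp add: K_def)
  qed
qed

lemma summable_Gamma_linear:
  fixes x d :: real
  assumes "0 < \<nu>" "\<nu> \<le> 1/2"
  shows "summable (\<lambda>n. x ^ n * Gamma (\<nu> * real n + d) / fact n)"
proof (rule summable_comparison_test_ev)
  show "summable (\<lambda>n. \<bar>x\<bar> ^ n * sqrt (fact (n + nat \<lceil>2 * \<bar>d\<bar> + 2\<rceil>)) / fact n :: real)"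
    by (rule summable_power_sqrt_fact)
  show "\<forall>\<^sub>F n in sequentially. norm (x ^ n * Gamma (\<nu> * real n + d) / fact n)
      \<le> \<bar>x\<bar> ^ n * sqrt (fact (n + nat \<lceil>2 * \<bar>d\<bar> + 2\<rceil>)) / fact n"
    using Gamma_linear_bound[OF assms(1), of "\<bar>d\<bar>"]
  proof eventually_elim
    case (elim n)
    have "2 \<le> \<nu> * real n + d" "Gamma (\<nu> * real n + d) \<le> sqrt (fact (n + nat \<lceil>2 * \<bar>d\<bar> + 2\<rceil>))"
      using elim assms by auto
    moreover from this have "0 < Gamma (\<nu> * real n + d)"
      by (intro Gamma_real_pos) auto
    ultimately show ?case
      by (auto simp: abs_mult power_abs intro!: divide_right_mono mult_left_mono)
  qed
qed

section \<open>The Wright series: continuity, derivative, recurrence\<close>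

definition Wright_term :: "nat \<Rightarrow> real \<Rightarrow> real \<Rightarrow> real \<Rightarrow> real" where
  "Wright_term n z a b = z ^ n * rGamma (real n * a + b) / fact n"

text \<open>Reflection reduces the coefficient to Gamma at \<nu> n + (1 - b); the shift 1 - b is at
  most \<open>B + 1\<close> in modulus, which explains the constant.\<close>

lemma Wright_term_bound:
  assumes "0 < a"
  shows "\<forall>\<^sub>F n in sequentially. \<forall>p\<in>{-R..R} \<times> {a..1/2} \<times> {-B..B}.
    norm (Wright_term n (fst p) (- fst (snd p)) (snd (snd p)))
      \<le> R ^ n * sqrt (fact (n + nat \<lceil>2 * (B + 1) + 2\<rceil>)) / fact n"
  using Gamma_linear_bound[OF assms, of "B + 1"]
proof eventually_elim
  case (elim n)
  show ?case
  proof
    fix p assume p_in: "p \<in> {-R..R} \<times> {a..1/2} \<times> {-B..B}"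
    obtain z \<nu> b where p: "p = (z, \<nu>, b)" by (cases p)
    have *: "z \<in> {-R..R}" "\<nu> \<in> {a..1/2}" "b \<in> {-B..B}"
      using p_in by (auto simp: p)
    have **: "2 \<le> \<nu> * real n + (1 - b)"
      "Gamma (\<nu> * real n + (1 - b)) \<le> sqrt (fact (n + nat \<lceil>2 * (B + 1) + 2\<rceil>))"
      using elim *(2,3) by (auto simp: abs_le_iff)
    have "\<bar>rGamma (real n * (- \<nu>) + b)\<bar> \<le> Gamma (1 - (real n * (- \<nu>) + b))"
      using **(1) by (intro abs_rGamma_le_Gamma) (auto simp: algebra_simps)
    also have "\<dots> \<le> sqrt (fact (n + nat \<lceil>2 * (B + 1) + 2\<rceil>))"
      using **(2) by (simp add: algebra_simps)
    finally have "\<bar>z\<bar> ^ n * \<bar>rGamma (real n * (- \<nu>) + b)\<bar> / fact n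
        \<le> R ^ n * sqrt (fact (n + nat \<lceil>2 * (B + 1) + 2\<rceil>)) / fact n"
      using * by (intro divide_right_mono mult_mono power_mono) auto
    then show "norm (Wright_term n (fst p) (- fst (snd p)) (snd (snd p)))
        \<le> R ^ n * sqrt (fact (n + nat \<lceil>2 * (B + 1) + 2\<rceil>)) / fact n"
      by (simp add: p Wright_term_def abs_mult power_abs)
  qed
qed

text \<open>Weierstrass M-test. Continuity is joint in all three arguments because the last
  parameter is later 1 - \<nu> or 1 - 2\<nu> and moves together with \<nu>.\<close>

lemma continuous_on_Wright:
  assumes "0 < a"
  shows "continuous_on ({-R..R} \<times> {a..1/2} \<times> {-B..B})
    (\<lambda>p. Wright (fst p) (- fst (snd p)) (snd (snd p)))"
proof -
  have "continuous_on ({-R..R} \<times> {a..1/2} \<times> {-B..B})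
    (\<lambda>p. \<Sum>n. Wright_term n (fst p) (- fst (snd p)) (snd (snd p)))"
  proof (rule uniform_limit_theorem)
    show "uniform_limit ({-R..R} \<times> {a..1/2} \<times> {-B..B})
      (\<lambda>N p. \<Sum>n<N. Wright_term n (fst p) (- fst (snd p)) (snd (snd p)))
      (\<lambda>p. \<Sum>n. Wright_term n (fst p) (- fst (snd p)) (snd (snd p))) sequentially"
      by (rule Weierstrass_m_test_ev[OF Wright_term_bound[OF assms] summable_power_sqrt_fact])
    show "\<forall>\<^sub>F N in sequentially. continuous_on ({-R..R} \<times> {a..1/2} \<times> {-B..B})
      (\<lambda>p. \<Sum>n<N. Wright_term n (fst p) (- fst (snd p)) (snd (snd p)))"
      unfolding Wright_term_def
      by (intro always_eventually allI continuous_intros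
          continuous_on_compose2[OF continuous_on_rGamma[of UNIV]]) auto
  qed auto
  then show ?thesis
    by (simp add: Wright_def Wright_term_def)
qed

lemma summable_Wright:
  assumes "0 < \<nu>" "\<nu> \<le> 1/2"
  shows "summable (\<lambda>n. z ^ n * rGamma (real n * (- \<nu>) + b) / fact n)"
proof (rule summable_comparison_test_ev)
  show "summable (\<lambda>n. \<bar>z\<bar> ^ n * sqrt (fact (n + nat \<lceil>2 * (\<bar>b\<bar> + 1) + 2\<rceil>)) / fact n :: real)"
    by (rule summable_power_sqrt_fact)
  show "\<forall>\<^sub>F n in sequentially. norm (z ^ n * rGamma (real n * (- \<nu>) + b) / fact n)
      \<le> \<bar>z\<bar> ^ n * sqrt (fact (n + nat \<lceil>2 * (\<bar>b\<bar> + 1) + 2\<rceil>)) / fact n"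
    using Wright_term_bound[OF assms(1), of "\<bar>z\<bar>" "\<bar>b\<bar>"]
  proof eventually_elim
    case (elim n)
    have "(z, \<nu>, b) \<in> {-\<bar>z\<bar>..\<bar>z\<bar>} \<times> {\<nu>..1/2} \<times> {-\<bar>b\<bar>..\<bar>b\<bar>}"
      using assms by auto
    from bspec[OF elim this] show ?case
      by (simp add: Wright_term_def)
  qed
qed

lemma Wright_0: "Wright 0 a b = rGamma b"
proof -
  have "Wright 0 a b = (\<Sum>n. rGamma (real n * a + b) / fact n * 0 ^ n)"
    by (simp add: Wright_def mult_ac)
  also have "\<dots> = rGamma b"
    by (subst powser_zero) simp
  finally show ?thesis .
qed

text \<open>Termwise differentiation shifts the index by one, and this shift is absorbed by lowering
  \<open>b\<close> by \<nu>.\<close>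

lemma DERIV_Wright:
  assumes "0 < \<nu>" "\<nu> \<le> 1/2"
  shows "((\<lambda>z. Wright z (- \<nu>) b) has_real_derivative Wright z (- \<nu>) (b - \<nu>)) (at z)"
proof -
  let ?c = "\<lambda>n. rGamma (real n * (- \<nu>) + b) / fact n"
  have "((\<lambda>z. \<Sum>n. ?c n * z ^ n) has_real_derivative (\<Sum>n. diffs ?c n * z ^ n)) (at z)"
    using summable_Wright[OF assms]
    by (intro termdiffs_strong_converges_everywhere) (simp add: mult_ac)
  moreover have "diffs ?c n * z ^ n = z ^ n * rGamma (real n * (- \<nu>) + (b - \<nu>)) / fact n" for n
  proof -
    have "real (Suc n) * (- \<nu>) + b = real n * (- \<nu>) + (b - \<nu>)"
      by (simp add: algebra_simps)
    then show ?thesis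
      by (simp add: diffs_def field_simps del: of_nat_Suc)
  qed
  ultimately show ?thesis
    by (simp add: Wright_def mult_ac)
qed

text \<open>By 1/Gamma(w - 1) = (w - 1)/Gamma(w), the right-hand side is the series for
  \<open>b\<close> with its terms multiplied by -\<nu> n; an index shift turns this into the
  left-hand side. At b = 1 the last term drops out.\<close>

lemma Wright_recurrence:
  assumes "0 < \<nu>" "\<nu> \<le> 1/2"
  shows "- \<nu> * z * Wright z (- \<nu>) (b - \<nu>) = Wright z (- \<nu>) (b - 1) + (1 - b) * Wright z (- \<nu>) b"
proof -
  let ?t = "\<lambda>b n. z ^ n * rGamma (real n * (- \<nu>) + b) / fact n"
  have s: "?t b' sums Wright z (- \<nu>) b'" for b'
    unfolding Wright_def by (rule summable_sums[OF summable_Wright[OF assms]])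
  have rG: "rGamma (w - 1) = (w - 1) * rGamma w" for w :: real
    using rGamma_plus1[of "w - 1"] by simp
  have "(\<lambda>n. ?t (b - 1) n + (1 - b) * ?t b n) sums (Wright z (- \<nu>) (b - 1) + (1 - b) * Wright z (- \<nu>) b)"
    by (intro sums_add sums_mult s)
  moreover have "?t (b - 1) n + (1 - b) * ?t b n = - \<nu> * real n * ?t b n" for n
  proof -
    have "rGamma (real n * (- \<nu>) + (b - 1)) = (real n * (- \<nu>) + b - 1) * rGamma (real n * (- \<nu>) + b)"
      using rG[of "real n * (- \<nu>) + b"] by (simp add: algebra_simps)
    then show ?thesis
      by (simp only:) (simp add: field_simps)
  qed
  ultimately have "(\<lambda>n. - \<nu> * real n * ?t b n) sums (Wright z (- \<nu>) (b - 1) + (1 - b) * Wright z (- \<nu>) b)"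
    by simp
  \<comment> \<open>The term at n = 0 vanishes, so the summation may start at 1.\<close>
  then have "(\<lambda>n. - \<nu> * real (Suc n) * ?t b (Suc n)) sums (Wright z (- \<nu>) (b - 1) + (1 - b) * Wright z (- \<nu>) b)"
    by (subst sums_Suc_iff) simp
  moreover have "(\<lambda>n. - \<nu> * real (Suc n) * ?t b (Suc n)) = (\<lambda>n. - \<nu> * z * ?t (b - \<nu>) n)"
  proof
    fix n
    have "real (Suc n) * (- \<nu>) + b = real n * (- \<nu>) + (b - \<nu>)"
      by (simp add: algebra_simps)
    then show "- \<nu> * real (Suc n) * ?t b (Suc n) = - \<nu> * z * ?t (b - \<nu>) n"
      by (simp only:) (simp add: field_simps del: of_nat_Suc)
  qed
  ultimately have "(\<lambda>n. - \<nu> * z * ?t (b - \<nu>) n) sums (Wright z (- \<nu>) (b - 1) + (1 - b) * Wright z (- \<nu>) b)"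
    by (simp only:)
  then show ?thesis
    using sums_mult[OF s[of "b - \<nu>"], of "- \<nu> * z"] sums_unique2 by blast
qed

section \<open>A bound for the Wright function on the negative axis\<close>

lemma has_bochner_integral_Gamma:
  fixes s :: real
  assumes "0 < s"
  shows "has_bochner_integral lborel (\<lambda>t. indicator {0..} t * t powr (s - 1) / exp t) (Gamma s)"
proof (rule has_bochner_integral_nn_integral)
  show "0 \<le> Gamma s"
    using Gamma_real_pos[OF assms] by simp
  show "(\<integral>\<^sup>+t. ennreal (indicator {0..} t * t powr (s - 1) / exp t) \<partial>lborel) = ennreal (Gamma s)"
    using Gamma_conv_nn_integral_real[OF assms] by simp
qed auto

text \<open>The series is the imaginary part of
  \<open>cis \<beta> * exp (- y * cis (- \<theta>))\<close>, whose modulus is exp (-y cos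
  \<theta>).\<close>

lemma abs_sin_exp_series_le_1:
  fixes y \<beta> \<theta> :: real
  assumes "0 \<le> y" "0 \<le> cos \<theta>"
  shows "\<bar>\<Sum>n. (- y) ^ n / fact n * sin (\<beta> - real n * \<theta>)\<bar> \<le> 1"
proof -
  define z where "z = - of_real y * cis (- \<theta>)"
  have "(\<lambda>n. Im (cis \<beta> * (z ^ n /\<^sub>R fact n))) sums Im (cis \<beta> * exp z)"
    by (intro sums_Im sums_mult exp_converges)
  moreover have "Im (cis \<beta> * (z ^ n /\<^sub>R fact n)) = (- y) ^ n / fact n * sin (\<beta> - real n * \<theta>)" for n
  proof -
    have "z ^ n = of_real ((- y) ^ n) * cis (- (real n * \<theta>))"
      using Complex.DeMoivre[of "- \<theta>" n] unfolding z_def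
      by (simp add: power_mult_distrib flip: of_real_minus of_real_power)
    then have "cis \<beta> * (z ^ n /\<^sub>R fact n) = of_real ((- y) ^ n / fact n) * cis (\<beta> - real n * \<theta>)"
      by (simp add: scaleR_conv_of_real cis_mult[symmetric] divide_inverse flip: cis_divide)
    moreover have "Im (of_real a * cis t) = a * sin t" for a t
      by simp
    ultimately show ?thesis
      by (simp only:)
  qed
  ultimately have "(\<Sum>n. (- y) ^ n / fact n * sin (\<beta> - real n * \<theta>)) = Im (cis \<beta> * exp z)"
    by (simp add: sums_iff)
  also have "\<bar>\<dots>\<bar> \<le> norm (cis \<beta> * exp z)"
    by (rule abs_Im_le_cmod)
  also have "\<dots> = exp (- y * cos \<theta>)"
    by (simp add: norm_mult z_def)
  also have "\<dots> \<le> 1"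
    using assms by simp
  finally show ?thesis .
qed

text \<open>Reflection and Euler's integral for Gamma write each term as an integral. After
  exchanging sum and integral, the inner series is the oscillating one above with y = x t^\<nu> and
  \<theta> = pi \<nu>, where cos \<theta> \<ge> 0 as \<nu> \<le> 1/2. The resulting bound does not
  depend on \<open>x\<close> or \<nu>.\<close>

lemma abs_Wright_le:
  fixes x \<nu> b :: real
  assumes "0 < \<nu>" "\<nu> \<le> 1/2" "b < 1" "0 \<le> x"
  shows "\<bar>Wright (- x) (- \<nu>) b\<bar> \<le> Gamma (1 - b) / pi"
proof -
  \<comment> \<open>\<open>g s\<close> is Euler's integrand for Gamma at \<open>s\<close>,
    \<open>r n\<close> collects the factors independent of \<open>t\<close>, and \<open>f n\<close>
    integrates to the \<open>n\<close>-th Wright term.\<close>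
  define g where "g s t = indicator {0..} t * t powr (s - 1) / exp t" for s t :: real
  define r where "r n = (- x) ^ n / fact n * sin (pi * b - real n * (pi * \<nu>)) / pi" for n
  define f where "f n t = r n * g (1 - b + \<nu> * real n) t" for n t
  have pos: "0 < 1 - b + \<nu> * real n" for n
    using assms by (intro add_pos_nonneg) auto
  have g_int: "has_bochner_integral lborel (g s) (Gamma s)" if "0 < s" for s
    using has_bochner_integral_Gamma[OF that] unfolding g_def .
  have g_nonneg: "0 \<le> g s t" for s t
    by (simp add: g_def)
  have f_int: "has_bochner_integral lborel (f n) (r n * Gamma (1 - b + \<nu> * real n))" for n
    unfolding f_def by (intro has_bochner_integral_mult_right g_int pos)
  have f_norm_int: "(\<integral>t. norm (f n t) \<partial>lborel) = \<bar>r n\<bar> * Gamma (1 - b + \<nu> * real n)" for n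
    using has_bochner_integral_integral_eq[OF has_bochner_integral_mult_right[OF g_int[OF pos]], of "\<bar>r n\<bar>" n]
    by (simp add: f_def abs_mult g_nonneg)
  have r_le: "\<bar>r n\<bar> \<le> x ^ n / fact n" for n
  proof -
    have "\<bar>sin (pi * b - real n * (pi * \<nu>))\<bar> / pi \<le> 1"
      using order_trans[OF abs_sin_le_one[of "pi * b - real n * (pi * \<nu>)"], of pi] pi_gt3 by simp
    then have "x ^ n / fact n * (\<bar>sin (pi * b - real n * (pi * \<nu>))\<bar> / pi) \<le> x ^ n / fact n * 1"
      using assms by (intro mult_left_mono) auto
    then show ?thesis
      using assms by (simp add: r_def abs_mult power_abs)
  qed
  \<comment> \<open>Splitting off the power makes the sum over \<open>n\<close> an exponential-type
    series in x t^\<nu>. At t = 0 both sides vanish, since \<open>powr\<close> is 0 there.\<close>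
  have g_eq: "g (1 - b + \<nu> * real n) t = g (1 - b) t * (t powr \<nu>) ^ n" for n t
  proof (cases "0 < t")
    case True
    have "t powr (1 - b + \<nu> * real n - 1) = t powr (- b) * (t powr \<nu>) powr real n"
      by (simp add: powr_powr flip: powr_add)
    also have "(t powr \<nu>) powr real n = (t powr \<nu>) ^ n"
      using True by (subst powr_realpow) auto
    finally show ?thesis
      by (simp add: g_def)
  qed (auto simp: g_def indicator_def)
  have f_summable: "summable (\<lambda>n. norm (f n t))" for t
  proof (rule summable_comparison_test')
    show "summable (\<lambda>n. g (1 - b) t * (inverse (fact n) * (x * t powr \<nu>) ^ n))"
      by (intro summable_mult summable_exp)
    fix n :: nat
    have "\<bar>r n\<bar> * (g (1 - b) t * (t powr \<nu>) ^ n) \<le> x ^ n / fact n * (g (1 - b) t * (t powr \<nu>) ^ n)"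
      by (intro mult_right_mono r_le mult_nonneg_nonneg g_nonneg) auto
    then show "norm (norm (f n t)) \<le> g (1 - b) t * (inverse (fact n) * (x * t powr \<nu>) ^ n)"
      unfolding f_def g_eq by (simp add: abs_mult g_nonneg power_mult_distrib field_simps)
  qed
  \<comment> \<open>Absolute summability of the integrals, which licenses the exchange of sum and
    integral.\<close>
  have summable_norm_int: "summable (\<lambda>n. \<integral>t. norm (f n t) \<partial>lborel)"
  proof (rule summable_comparison_test')
    show "summable (\<lambda>n. x ^ n * Gamma (\<nu> * real n + (1 - b)) / fact n)"
      by (rule summable_Gamma_linear[OF assms(1,2)])
    fix n :: nat
    have G: "0 < Gamma (1 - b + \<nu> * real n)"
      by (rule Gamma_real_pos[OF pos])
    have "\<bar>r n\<bar> * Gamma (1 - b + \<nu> * real n) \<le> x ^ n / fact n * Gamma (1 - b + \<nu> * real n)"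
      using G by (intro mult_right_mono r_le) auto
    then show "norm (\<integral>t. norm (f n t) \<partial>lborel) \<le> x ^ n * Gamma (\<nu> * real n + (1 - b)) / fact n"
      using G f_norm_int[of n] by (simp add: abs_mult add_ac)
  qed
  have f_integrable: "integrable lborel (f n)" for n
    using f_int by (auto simp: has_bochner_integral_iff)
  have term_eq: "(- x) ^ n * rGamma (real n * (- \<nu>) + b) / fact n = (\<integral>t. f n t \<partial>lborel)" for n
  proof -
    have "rGamma (real n * (- \<nu>) + b) = Gamma (1 - (real n * (- \<nu>) + b)) * sin (pi * (real n * (- \<nu>) + b)) / pi"
      using pos[of n] by (intro rGamma_eq_Gamma_sin) (simp add: algebra_simps)
    moreover have "1 - (real n * (- \<nu>) + b) = 1 - b + \<nu> * real n"
      "pi * (real n * (- \<nu>) + b) = pi * b - real n * (pi * \<nu>)"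
      by (simp_all add: algebra_simps)
    ultimately have "rGamma (real n * (- \<nu>) + b)
        = Gamma (1 - b + \<nu> * real n) * sin (pi * b - real n * (pi * \<nu>)) / pi"
      by (simp only:)
    then show ?thesis
      by (simp only: has_bochner_integral_integral_eq[OF f_int]) (simp add: r_def mult_ac)
  qed
  have ae: "AE t in lborel. summable (\<lambda>n. norm (f n t))"
    using f_summable by simp
  have "Wright (- x) (- \<nu>) b = (\<integral>t. (\<Sum>n. f n t) \<partial>lborel)"
    unfolding Wright_def term_eq
    by (rule integral_suminf[symmetric, OF f_integrable ae summable_norm_int])
  also have "\<bar>\<dots>\<bar> \<le> (\<integral>t. norm (\<Sum>n. f n t) \<partial>lborel)"
    using integral_norm_bound[of lborel "\<lambda>t. \<Sum>n. f n t"] by simp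
  also have "\<dots> \<le> (\<integral>t. g (1 - b) t / pi \<partial>lborel)"
  proof (rule integral_mono)
    show "integrable lborel (\<lambda>t. norm (\<Sum>n. f n t))"
      by (intro integrable_norm integrable_suminf[OF f_integrable ae summable_norm_int])
    show "integrable lborel (\<lambda>t. g (1 - b) t / pi)"
      using g_int[of "1 - b"] assms by (auto simp: has_bochner_integral_iff)
    fix t :: real
    let ?q = "\<lambda>n. (- (x * t powr \<nu>)) ^ n / fact n * sin (pi * b - real n * (pi * \<nu>))"
    have "pi * \<nu> \<le> pi * (1/2)"
      using assms by (intro mult_left_mono) auto
    then have "0 \<le> cos (pi * \<nu>)"
      using assms by (intro cos_ge_zero) (auto intro: order_trans[of _ 0])
    then have q: "\<bar>suminf ?q\<bar> \<le> 1"
      using assms by (intro abs_sin_exp_series_le_1) auto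
    have f_eq: "f n t = g (1 - b) t / pi * ?q n" for n
      using power_mult_distrib[of "- x" "t powr \<nu>" n]
      unfolding f_def r_def g_eq by (simp add: field_simps)
    have "(\<Sum>n. f n t) = (\<Sum>n. g (1 - b) t / pi * ?q n)"
      by (simp only: f_eq)
    also have "\<dots> = g (1 - b) t / pi * suminf ?q"
    \<comment> \<open>Summability of \<open>?q\<close> is obtained by cancelling the factor, so it
      must be nonzero; otherwise both sides are 0.\<close>
    proof (cases "g (1 - b) t = 0")
      case False
      have "summable (\<lambda>n. f n t)"
        by (rule summable_norm_cancel[OF f_summable])
      then have "summable (\<lambda>n. g (1 - b) t / pi * ?q n)"
        by (simp only: f_eq)
      then have "summable ?q"
        using False by (subst (asm) summable_cmult_iff) auto
      then show ?thesis
        by (rule suminf_mult)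
    qed simp
    finally have "norm (\<Sum>n. f n t) = g (1 - b) t / pi * \<bar>suminf ?q\<bar>"
      by (simp add: abs_mult g_nonneg)
    also have "\<dots> \<le> g (1 - b) t / pi * 1"
      using q by (intro mult_left_mono) (auto simp: g_nonneg)
    finally show "norm (\<Sum>n. f n t) \<le> g (1 - b) t / pi"
      by simp
  qed
  also have "\<dots> = Gamma (1 - b) / pi"
    using g_int[of "1 - b"] assms by (simp add: has_bochner_integral_integral_eq)
  finally show ?thesis .
qed

section \<open>The Mainardi function, its primitive, and decay uniform in \<nu>\<close>

text \<open>The primitive of M_\<nu> that vanishes at 0, named after the reading of M_\<nu> as a
  probability density on the positive half-line.\<close>

definition Mainardi_cdf :: "real \<Rightarrow> real \<Rightarrow> real" where
  "Mainardi_cdf \<nu> x = 1 - Wright (- x) (- \<nu>) 1"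

lemma Mainardi_cdf_0: "Mainardi_cdf \<nu> 0 = 0"
  by (simp add: Mainardi_cdf_def Wright_0)

lemma DERIV_Mainardi_cdf:
  assumes "0 < \<nu>" "\<nu> \<le> 1/2"
  shows "(Mainardi_cdf \<nu> has_real_derivative Mainardi \<nu> x) (at x)"
proof -
  have "((\<lambda>x. Wright (- x) (- \<nu>) 1) has_real_derivative Wright (- x) (- \<nu>) (1 - \<nu>) * - 1) (at x)"
    by (rule DERIV_chain2[OF DERIV_Wright[OF assms]]) (auto intro!: derivative_eq_intros)
  from DERIV_diff[OF DERIV_const this, of 1] show ?thesis
    by (simp add: Mainardi_def Mainardi_cdf_def[abs_def])
qed

lemma DERIV_Mainardi:
  assumes "0 < \<nu>" "\<nu> \<le> 1/2"
  shows "(Mainardi \<nu> has_real_derivative - Wright (- x) (- \<nu>) (1 - 2 * \<nu>)) (at x)"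
proof -
  have "((\<lambda>x. Wright (- x) (- \<nu>) (1 - \<nu>)) has_real_derivative Wright (- x) (- \<nu>) (1 - \<nu> - \<nu>) * - 1) (at x)"
    by (rule DERIV_chain2[OF DERIV_Wright[OF assms]]) (auto intro!: derivative_eq_intros)
  then show ?thesis
    by (simp add: Mainardi_def[abs_def] algebra_simps)
qed

text \<open>The convex function ln Gamma vanishes at 1 and at 2.\<close>

lemma Gamma_le_1:
  fixes s :: real
  assumes "1 \<le> s" "s \<le> 2"
  shows "Gamma s \<le> 1"
proof -
  have "ln (Gamma ((1 - (s - 1)) *\<^sub>R 1 + (s - 1) *\<^sub>R 2)) \<le> (1 - (s - 1)) * ln (Gamma 1) + (s - 1) * ln (Gamma 2)"
    using convex_onD[OF log_convex_Gamma_real, of "s - 1" 1 2] assms by auto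
  moreover have "(1 - (s - 1)) *\<^sub>R 1 + (s - 1) *\<^sub>R 2 = s"
    by (simp add: algebra_simps)
  moreover have "Gamma (2::real) = 1"
    using Gamma_fact[of 1, where 'a = real] by simp
  ultimately have "ln (Gamma s) \<le> 0"
    by simp
  moreover have "0 < Gamma s"
    using assms by (intro Gamma_real_pos) auto
  ultimately show ?thesis
    by simp
qed

text \<open>The recurrence at b = 1 and then at b = \<nu> expresses (\<nu> x)^2 M_\<nu>(x) by two
  Wright values with last parameter below 1. Each contributes at most Gamma(2 - \<nu>)/pi \<le>
  1/pi; with \<nu> \<ge> 1/4 this gives 32/pi < 11.\<close>

lemma abs_Mainardi_le:
  assumes "1/4 \<le> \<nu>" "\<nu> \<le> 1/2" "0 < x"
  shows "\<bar>Mainardi \<nu> x\<bar> \<le> 11 / x\<^sup>2"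
proof -
  have \<nu>: "0 < \<nu>" "\<nu> \<le> 1/2"
    using assms by auto
  have G: "Gamma (2 - \<nu>) \<le> 1"
    using assms by (intro Gamma_le_1) auto
  have G': "(1 - \<nu>) * Gamma (1 - \<nu>) = Gamma (2 - \<nu>)"
  proof -
    have "1 - \<nu> \<notin> \<int>\<^sub>\<le>\<^sub>0"
      using assms by (auto elim!: nonpos_Ints_cases)
    from Gamma_plus1[OF this] show ?thesis
      by (simp add: algebra_simps)
  qed
  have "\<nu> * x * Mainardi \<nu> x = Wright (- x) (- \<nu>) 0"
    using Wright_recurrence[OF \<nu>, of "- x" 1] by (simp add: Mainardi_def)
  then have "\<nu> * x * (\<nu> * x * Mainardi \<nu> x)
      = Wright (- x) (- \<nu>) (\<nu> - 1) + (1 - \<nu>) * Wright (- x) (- \<nu>) \<nu>"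
    using Wright_recurrence[OF \<nu>, of "- x" \<nu>] by simp
  also have "\<bar>\<dots>\<bar> \<le> \<bar>Wright (- x) (- \<nu>) (\<nu> - 1)\<bar> + (1 - \<nu>) * \<bar>Wright (- x) (- \<nu>) \<nu>\<bar>"
    using \<nu> by (intro order_trans[OF abs_triangle_ineq]) (simp add: abs_mult)
  also have "\<dots> \<le> Gamma (1 - (\<nu> - 1)) / pi + (1 - \<nu>) * (Gamma (1 - \<nu>) / pi)"
    using assms by (intro add_mono mult_left_mono abs_Wright_le) auto
  also have "\<dots> = 2 * Gamma (2 - \<nu>) / pi"
    by (simp add: G'[symmetric] algebra_simps)
  also have "\<dots> \<le> 2 / pi"
    using G by (intro divide_right_mono) auto
  finally have "\<nu>\<^sup>2 * (x\<^sup>2 * \<bar>Mainardi \<nu> x\<bar>) \<le> 2 / pi"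
    using assms by (simp add: abs_mult power2_eq_square mult_ac)
  moreover have "(1/4)\<^sup>2 * (x\<^sup>2 * \<bar>Mainardi \<nu> x\<bar>) \<le> \<nu>\<^sup>2 * (x\<^sup>2 * \<bar>Mainardi \<nu> x\<bar>)"
    using assms by (intro mult_right_mono power_mono) auto
  ultimately have "x\<^sup>2 * \<bar>Mainardi \<nu> x\<bar> \<le> 32 / pi"
    by (simp add: power2_eq_square)
  also have "\<dots> \<le> 32 / 3"
    using pi_gt3 by (intro divide_left_mono) auto
  finally show ?thesis
    using assms by (simp add: field_simps)
qed

text \<open>Adding 11/y^2 makes the derivative nonnegative even where M_\<nu> might be negative.
  Hence the primitive cannot fall back towards 0 beyond a large \<open>R\<close>.\<close>

lemma Mainardi_cdf_ge:
  assumes "1/4 \<le> \<nu>" "\<nu> \<le> 1/2" "0 < R" "R \<le> x"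
  shows "Mainardi_cdf \<nu> R - 11 / R \<le> Mainardi_cdf \<nu> x"
proof -
  have "Mainardi_cdf \<nu> R - 11 / R \<le> Mainardi_cdf \<nu> x - 11 / x"
  proof (rule DERIV_nonneg_imp_nondecreasing[OF assms(4)])
    fix y assume y: "R \<le> y" "y \<le> x"
    have "((\<lambda>y. Mainardi_cdf \<nu> y - 11 / y) has_real_derivative Mainardi \<nu> y + 11 / y\<^sup>2) (at y)"
      using assms y DERIV_Mainardi_cdf[of \<nu> y]
      by (auto intro!: derivative_eq_intros simp: power2_eq_square)
    moreover have "0 \<le> Mainardi \<nu> y + 11 / y\<^sup>2"
      using abs_Mainardi_le[of \<nu> y] assms y by (auto simp: abs_le_iff)
    ultimately show "\<exists>z. ((\<lambda>y. Mainardi_cdf \<nu> y - 11 / y) has_real_derivative z) (at y) \<and> 0 \<le> z"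
      by blast
  qed
  also have "\<dots> \<le> Mainardi_cdf \<nu> x"
    using assms by simp
  finally show ?thesis .
qed

section \<open>The Gaussian case \<nu> = 1/2\<close>

text \<open>At \<nu> = 1/2 the parameter 1 - 2\<nu> of -M' is 0, so the recurrence at b = 1 closes
  into a first-order differential equation for M.\<close>

lemma Wright_half_0: "Wright (- x) (- (1/2)) 0 = x / 2 * Mainardi (1/2) x"
  using Wright_recurrence[of "1/2" "- x" 1] by (simp add: Mainardi_def)

text \<open>By M' = -x M / 2 the product \<open>?h\<close> is constant, and its value at 0 is
  1/Gamma(1/2).\<close>

lemma Mainardi_half: "Mainardi (1/2) x = exp (- (x\<^sup>2 / 4)) / sqrt pi"
proof -
  let ?h = "\<lambda>x. Mainardi (1/2) x * exp (x\<^sup>2 / 4)"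
  have "(?h has_real_derivative 0) (at y)" for y
  proof -
    have "(Mainardi (1/2) has_real_derivative - (y / 2 * Mainardi (1/2) y)) (at y)"
      using DERIV_Mainardi[of "1/2" y] Wright_half_0[of y] by simp
    then show ?thesis
      by (auto intro!: derivative_eq_intros)
  qed
  then have "?h x = ?h 0"
    by (intro DERIV_isconst_all) auto
  moreover have "Mainardi (1/2) 0 = 1 / sqrt pi"
    by (simp add: Mainardi_def Wright_0 rGamma_inverse_Gamma Gamma_one_half_real inverse_eq_divide)
  ultimately show ?thesis
    by (simp add: exp_minus field_simps)
qed

text \<open>Both sides have the same derivative and vanish at 0. The factor 2 comes from the
  exponent x^2/4 and is the reason why \<xi> tends to 2\<mu>.\<close>

lemma Mainardi_cdf_half:
  assumes "0 \<le> x"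
  shows "Mainardi_cdf (1/2) (2 * x) = erf x"
proof -
  let ?G = "\<lambda>u. Mainardi_cdf (1/2) (2 * u)"
  have "(?G has_real_derivative 2 / sqrt pi * exp (- u\<^sup>2)) (at u)" for u
  proof -
    have "(?G has_real_derivative Mainardi (1/2) (2 * u) * 2) (at u)"
      by (rule DERIV_chain2[OF DERIV_Mainardi_cdf]) (auto intro!: derivative_eq_intros)
    then show ?thesis
      by (simp add: Mainardi_half mult_ac)
  qed
  then have "((\<lambda>u. 2 / sqrt pi * exp (- u\<^sup>2)) has_integral ?G x - ?G 0) {0..x}"
    using assms
    by (intro fundamental_theorem_of_calculus)
      (auto simp flip: has_real_derivative_iff_has_vector_derivative intro: has_field_derivative_at_within)
  then have "integral {0..x} (\<lambda>u. 2 / sqrt pi * exp (- u\<^sup>2)) = ?G x - ?G 0"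
    by (rule integral_unique)
  then show ?thesis
    using assms by (simp add: erf_def Mainardi_cdf_0)
qed

section \<open>The ratio in the equation for \<xi>: monotonicity and the limiting root\<close>

text \<open>Left-hand side of the equation defining \<open>xi4\<close>, with \<nu> = \<alpha>/2; its
  value is 0 where M_\<nu> vanishes.\<close>

definition Mainardi_ratio :: "real \<Rightarrow> real \<Rightarrow> real" where
  "Mainardi_ratio \<nu> x = x * Mainardi_cdf \<nu> x / Mainardi \<nu> x"

lemma DERIV_Mainardi_ratio:
  assumes "0 < \<nu>" "\<nu> \<le> 1/2" "Mainardi \<nu> x \<noteq> 0"
  shows "(Mainardi_ratio \<nu> has_real_derivative
    ((Mainardi_cdf \<nu> x + x * Mainardi \<nu> x) * Mainardi \<nu> x
      + x * Mainardi_cdf \<nu> x * Wright (- x) (- \<nu>) (1 - 2 * \<nu>)) / (Mainardi \<nu> x)\<^sup>2) (at x)"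
  unfolding Mainardi_ratio_def[abs_def]
  using DERIV_Mainardi_cdf[OF assms(1,2), of x] DERIV_Mainardi[OF assms(1,2), of x] assms(3)
  by (auto intro!: derivative_eq_intros simp: power2_eq_square)

lemma Mainardi_cdf_pos:
  assumes "0 < \<nu>" "\<nu> \<le> 1/2" "0 < x" "\<And>y. 0 \<le> y \<Longrightarrow> y \<le> x \<Longrightarrow> 0 < Mainardi \<nu> y"
  shows "0 < Mainardi_cdf \<nu> x"
proof -
  have "Mainardi_cdf \<nu> 0 < Mainardi_cdf \<nu> x"
    using DERIV_Mainardi_cdf[OF assms(1,2)] assms(3,4)
    by (intro DERIV_pos_imp_increasing[of 0 x "Mainardi_cdf \<nu>"]) blast+
  then show ?thesis
    by (simp add: Mainardi_cdf_0)
qed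

text \<open>With F the primitive of M and W = -M', the numerator of the derivative is F (M + z W) +
  z M^2. The bounds \<open>m\<close> and \<epsilon> keep M + z W positive on the whole interval up
  to \<open>R\<close>.\<close>

lemma Mainardi_ratio_less:
  assumes \<nu>: "0 < \<nu>" "\<nu> \<le> 1/2"
    and m: "\<And>z. 0 \<le> z \<Longrightarrow> z \<le> R \<Longrightarrow> m \<le> Mainardi \<nu> z" "0 < m"
    and \<epsilon>: "\<And>z. 0 \<le> z \<Longrightarrow> z \<le> R \<Longrightarrow> - \<epsilon> \<le> Wright (- z) (- \<nu>) (1 - 2 * \<nu>)" "0 \<le> \<epsilon>" "R * \<epsilon> < m"
    and xy: "0 < x" "x < y" "y \<le> R"
  shows "Mainardi_ratio \<nu> x < Mainardi_ratio \<nu> y"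
proof (rule DERIV_pos_imp_increasing[OF \<open>x < y\<close>])
  fix z assume z: "x \<le> z" "z \<le> y"
  then have z': "0 < z" "z \<le> R"
    using xy by auto
  have M: "m \<le> Mainardi \<nu> z"
    using m(1) z' by auto
  have F: "0 < Mainardi_cdf \<nu> z"
    using Mainardi_cdf_pos[OF \<nu> z'(1)] m z' by (meson less_le_trans order_trans)
  have "z * \<epsilon> \<le> R * \<epsilon>"
    using z' \<epsilon>(2) by (intro mult_right_mono) auto
  then have "0 < m - z * \<epsilon>"
    using \<epsilon>(3) by simp
  also have "\<dots> \<le> Mainardi \<nu> z + z * Wright (- z) (- \<nu>) (1 - 2 * \<nu>)"
    using M mult_left_mono[OF \<epsilon>(1)[of z], of z] z' by simp
  finally have "0 < Mainardi_cdf \<nu> z * (Mainardi \<nu> z + z * Wright (- z) (- \<nu>) (1 - 2 * \<nu>))"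
    using F by simp
  moreover have "0 < z * (Mainardi \<nu> z)\<^sup>2"
    using z' M m(2) by simp
  ultimately have "0 < (Mainardi_cdf \<nu> z + z * Mainardi \<nu> z) * Mainardi \<nu> z
      + z * Mainardi_cdf \<nu> z * Wright (- z) (- \<nu>) (1 - 2 * \<nu>)"
    by (simp add: algebra_simps power2_eq_square)
  then show "\<exists>d. (Mainardi_ratio \<nu> has_real_derivative d) (at z) \<and> 0 < d"
    using DERIV_Mainardi_ratio[OF \<nu>, of z] M m(2)
    by (intro exI[of _ "((Mainardi_cdf \<nu> z + z * Mainardi \<nu> z) * Mainardi \<nu> z
      + z * Mainardi_cdf \<nu> z * Wright (- z) (- \<nu>) (1 - 2 * \<nu>)) / (Mainardi \<nu> z)\<^sup>2"]) auto
qed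

lemma Mainardi_half_ge:
  assumes "0 \<le> z" "z \<le> R"
  shows "exp (- (R\<^sup>2 / 4)) / sqrt pi \<le> Mainardi (1/2) z"
  using assms power_mono[of z R 2] by (auto simp: Mainardi_half intro!: divide_right_mono)

text \<open>In the Gaussian case -M' = z M / 2 is nonnegative, so \<epsilon> = 0 suffices and no
  restriction on the interval remains.\<close>

lemma Mainardi_ratio_half_less:
  assumes "0 < x" "x < y"
  shows "Mainardi_ratio (1/2) x < Mainardi_ratio (1/2) y"
proof (rule Mainardi_ratio_less[where R = y and m = "exp (- (y\<^sup>2 / 4)) / sqrt pi" and \<epsilon> = 0])
  show "- 0 \<le> Wright (- z) (- (1/2)) (1 - 2 * (1/2))" if "0 \<le> z" for z
    using that Wright_half_0[of z] by (simp add: Mainardi_half)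
qed (use assms Mainardi_half_ge in auto)

lemma Mainardi_ratio_half:
  assumes "0 \<le> x"
  shows "Mainardi_ratio (1/2) (2 * x) = 2 * sqrt pi * (x * exp (x\<^sup>2) * erf x)"
  using Mainardi_cdf_half[OF assms]
  by (simp add: Mainardi_ratio_def Mainardi_half exp_minus field_simps)

lemma erf_pos: "0 < x \<Longrightarrow> 0 < erf x"
  using Mainardi_cdf_pos[of "1/2" "2 * x"] Mainardi_cdf_half[of x] by (simp add: Mainardi_half)

text \<open>At 2x the Gaussian ratio is a positive multiple of the left-hand side, so strict
  monotonicity and the intermediate value theorem apply.\<close>

lemma ex1_x_exp_erf:
  assumes "0 < D"
  shows "\<exists>!x. 0 < x \<and> x * exp (x\<^sup>2) * erf x = D"
proof -
  have eq: "x * exp (x\<^sup>2) * erf x = D \<longleftrightarrow> Mainardi_ratio (1/2) (2 * x) = 2 * sqrt pi * D" if "0 < x" for x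
    using Mainardi_ratio_half[of x] that by simp
  \<comment> \<open>Chosen so that b > 1 and \<open>b * erf 1\<close> exceeds \<open>D\<close>,
    which makes \<open>b\<close> an upper end for the intermediate value theorem.\<close>
  define b where "b = 1 + 2 * D / erf 1"
  have e1: "0 < erf 1"
    by (rule erf_pos) simp
  have cont: "continuous_on {0..2 * b} (Mainardi_ratio (1/2))"
    using DERIV_Mainardi_ratio[of "1/2"]
    by (intro continuous_at_imp_continuous_on ballI DERIV_isCont) (auto simp: Mainardi_half)
  have b: "1 < b"
    using e1 assms by (simp add: b_def)
  have "Mainardi_cdf (1/2) 2 \<le> Mainardi_cdf (1/2) (2 * b)"
    using b DERIV_Mainardi_cdf[of "1/2"]
    by (intro DERIV_nonneg_imp_nondecreasing[of 2 "2 * b" "Mainardi_cdf (1/2)"])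
      (auto simp: Mainardi_half intro!: exI)
  then have "erf 1 \<le> erf b"
    using Mainardi_cdf_half[of 1] Mainardi_cdf_half[of b] b by simp
  have "D \<le> b * erf 1"
    using e1 assms by (simp add: b_def field_simps)
  also have "\<dots> \<le> b * erf b"
    using \<open>erf 1 \<le> erf b\<close> b by simp
  also have "\<dots> \<le> b * exp (b\<^sup>2) * erf b"
    using b e1 \<open>erf 1 \<le> erf b\<close> by (intro mult_right_mono) auto
  finally have "2 * sqrt pi * D \<le> Mainardi_ratio (1/2) (2 * b)"
    using b by (simp add: Mainardi_ratio_half)
  then obtain x where x: "0 \<le> x" "Mainardi_ratio (1/2) x = 2 * sqrt pi * D"
    using IVT'[of "Mainardi_ratio (1/2)" 0 "2 * sqrt pi * D" "2 * b"] cont b assms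
    by (auto simp: Mainardi_ratio_def)
  then have "x \<noteq> 0"
    using assms by (auto simp: Mainardi_ratio_def)
  then have "0 < x / 2 \<and> x / 2 * exp ((x / 2)\<^sup>2) * erf (x / 2) = D"
    using x eq[of "x / 2"] by simp
  moreover have "y = x / 2" if "0 < y" "y * exp (y\<^sup>2) * erf y = D" for y
  proof -
    have "Mainardi_ratio (1/2) (2 * y) = Mainardi_ratio (1/2) x"
      using that eq[of y] x by simp
    then show ?thesis
      using Mainardi_ratio_half_less[of "2 * y" x] Mainardi_ratio_half_less[of x "2 * y"] that x \<open>x \<noteq> 0\<close>
      by (cases "2 * y" x rule: linorder_cases) auto
  qed
  ultimately show ?thesis
    by blast
qed

section \<open>Passage to the limit \<nu> \<rightarrow> 1/2\<close>

text \<open>Joint continuity on a box with slack 1 around \<open>z\<close> and \<open>b0\<close>. In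
  \<nu> the box ends at 1/2, so the approach must be from below.\<close>

lemma tendsto_Wright:
  assumes "(\<zeta> \<longlongrightarrow> z) G" "(\<nu> \<longlongrightarrow> 1/2) G" "(b \<longlongrightarrow> b0) G" "\<forall>\<^sub>F t in G. \<nu> t \<le> 1/2"
  shows "((\<lambda>t. Wright (\<zeta> t) (- \<nu> t) (b t)) \<longlongrightarrow> Wright z (- (1/2)) b0) G"
proof -
  define R where "R = \<bar>z\<bar> + 1"
  define B where "B = \<bar>b0\<bar> + 1"
  have "((\<lambda>t. (\<zeta> t, \<nu> t, b t)) \<longlongrightarrow> (z, 1/2, b0)) G"
    by (intro tendsto_intros assms)
  moreover have "\<forall>\<^sub>F t in G. (\<zeta> t, \<nu> t, b t) \<in> {-R..R} \<times> {1/4..1/2} \<times> {-B..B}"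
  proof -
    have "\<forall>\<^sub>F t in G. - R < \<zeta> t" "\<forall>\<^sub>F t in G. \<zeta> t < R"
      by (rule order_tendstoD[OF assms(1)]; simp add: R_def abs_real_def)+
    moreover have "\<forall>\<^sub>F t in G. 1/4 < \<nu> t"
      by (rule order_tendstoD[OF assms(2)]) simp
    moreover have "\<forall>\<^sub>F t in G. - B < b t" "\<forall>\<^sub>F t in G. b t < B"
      by (rule order_tendstoD[OF assms(3)]; simp add: B_def abs_real_def)+
    ultimately show ?thesis
      using assms(4) by eventually_elim auto
  qed
  moreover have "(z, 1/2, b0) \<in> {-R..R} \<times> {1/4..1/2::real} \<times> {-B..B}"
    by (auto simp: R_def B_def abs_real_def)
  ultimately show ?thesis
    using continuous_on_tendsto_compose[OF continuous_on_Wright[of "1/4" R B]] by fastforce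
qed

lemma tendsto_half_at_left: "((\<lambda>\<nu>. \<nu>) \<longlongrightarrow> (1/2::real)) (at_left (1/2))"
  by (rule tendsto_ident_at)

lemma eventually_at_left_half: "\<forall>\<^sub>F \<nu> in at_left (1/2::real). 1/4 < \<nu> \<and> \<nu> < 1/2"
  using eventually_at_left_real[of "1/4" "1/2::real"] by (auto elim: eventually_mono)

text \<open>Uniform continuity on a compact rectangle. The parameter \<open>j\<close> covers M_\<nu>
  (j = 1) and -M_\<nu>' (j = 2) at once.\<close>

lemma eventually_Wright_near_half:
  fixes j :: real
  assumes "0 < R" "0 < e"
  shows "\<forall>\<^sub>F \<nu> in at_left (1/2). \<forall>x\<in>{0..R}.
    \<bar>Wright (- x) (- \<nu>) (1 - j * \<nu>) - Wright (- x) (- (1/2)) (1 - j * (1/2))\<bar> < e"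
proof -
  define B where "B = 1 + \<bar>j\<bar>"
  define K where "K = {0..R} \<times> {1/4..1/2::real}"
  define f where "f p = Wright (- fst p) (- snd p) (1 - j * snd p)" for p
  have cont: "continuous_on K f"
    unfolding f_def
  proof (rule continuous_on_compose2[OF continuous_on_Wright[of "1/4" R B], of K "\<lambda>p. (- fst p, snd p, 1 - j * snd p)", simplified])
    show "continuous_on K (\<lambda>p. (- fst p, snd p, 1 - j * snd p))"
      by (intro continuous_intros)
    have "\<bar>j * \<nu>\<bar> \<le> \<bar>j\<bar> * 1" if "1/4 \<le> \<nu>" "\<nu> \<le> 1/2" for \<nu>
      using that unfolding abs_mult by (intro mult_left_mono) auto
    then show "(\<lambda>p. (- fst p, snd p, 1 - j * snd p)) ` K \<subseteq> {- R..R} \<times> {1 / 4..1 / 2} \<times> {- B..B}"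
      using assms(1) by (fastforce simp: K_def B_def abs_le_iff)
  qed
  moreover have "compact K"
    by (simp add: K_def compact_Times)
  ultimately have "uniformly_continuous_on K f"
    by (rule compact_uniformly_continuous)
  then obtain d where d: "0 < d" "\<And>p q. p \<in> K \<Longrightarrow> q \<in> K \<Longrightarrow> dist q p < d \<Longrightarrow> dist (f q) (f p) < e"
    using assms(2) by (rule uniformly_continuous_onE) auto
  have "\<forall>\<^sub>F \<nu> in at_left (1/2). 1/2 - d < \<nu>"
    by (rule order_tendstoD[OF tendsto_half_at_left]) (use d in simp)
  then show ?thesis
    using eventually_at_left_half
  proof eventually_elim
    case (elim \<nu>)
    show ?case
    proof
      fix x assume "x \<in> {0..R}"
      then have "dist (f (x, \<nu>)) (f (x, 1/2)) < e"
        using elim by (intro d(2)) (auto simp: K_def dist_Pair_Pair dist_real_def)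
      then show "\<bar>Wright (- x) (- \<nu>) (1 - j * \<nu>) - Wright (- x) (- (1/2)) (1 - j * (1/2))\<bar> < e"
        by (simp add: f_def dist_real_def)
    qed
  qed
qed

lemma tendsto_Mainardi_cdf:
  assumes "(\<zeta> \<longlongrightarrow> z) G" "(\<nu> \<longlongrightarrow> 1/2) G" "\<forall>\<^sub>F t in G. \<nu> t \<le> 1/2"
  shows "((\<lambda>t. Mainardi_cdf (\<nu> t) (\<zeta> t)) \<longlongrightarrow> Mainardi_cdf (1/2) z) G"
  unfolding Mainardi_cdf_def by (intro tendsto_intros tendsto_Wright assms)

lemma tendsto_Mainardi_ratio:
  "((\<lambda>\<nu>. Mainardi_ratio \<nu> x) \<longlongrightarrow> Mainardi_ratio (1/2) x) (at_left (1/2))"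
  unfolding Mainardi_ratio_def Mainardi_def
proof (intro tendsto_intros tendsto_Wright tendsto_Mainardi_cdf tendsto_half_at_left)
  show "Wright (- x) (- (1 / 2)) (1 - 1 / 2) \<noteq> 0"
    using Mainardi_half[of x] by (simp add: Mainardi_def)
qed (use eventually_at_left_half in \<open>auto elim: eventually_mono\<close>)

lemma Mainardi_ratio_half_pos: "0 < x \<Longrightarrow> 0 < Mainardi_ratio (1/2) x"
  using Mainardi_ratio_half[of "x/2"] erf_pos[of "x/2"] by simp

section \<open>Existence, uniqueness and convergence of the root\<close>

text \<open>Pointwise limits at \<open>lo\<close> and \<open>hi\<close> trap a root near
  \<open>x0\<close>. Uniqueness is by monotonicity up to \<open>R\<close>; beyond \<open>R\<close>
  the ratio is either nonpositive or above \<open>C0 + 1\<close>, while \<open>C\<close> eventually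
  stays strictly between 0 and \<open>C0 + 1\<close>.\<close>

lemma Mainardi_ratio_root_near_half:
  fixes C :: "real \<Rightarrow> real"
  assumes x0: "0 < x0" and C: "(C \<longlongrightarrow> Mainardi_ratio (1/2) x0) (at_left (1/2))" and "0 < e"
  shows "\<forall>\<^sub>F \<nu> in at_left (1/2). \<exists>y. 0 < y \<and> \<bar>y - x0\<bar> < e \<and> Mainardi_ratio \<nu> y = C \<nu> \<and>
    (\<forall>x. 0 < x \<and> Mainardi_ratio \<nu> x = C \<nu> \<longrightarrow> x = y)"
proof -
  define C0 where "C0 = Mainardi_ratio (1/2) x0"
  \<comment> \<open>The entry \<open>x0 / 2\<close> keeps the left end positive.\<close>
  define lo where "lo = max (x0 / 2) (x0 - e / 2)"
  define hi where "hi = x0 + e / 2"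
  \<comment> \<open>The limiting primitive is at least 3c at \<open>R\<close>, hence above 2c for
    nearby \<nu>; one c is spent on the tail loss 11/R, and c remains.\<close>
  define c where "c = Mainardi_cdf (1/2) 1 / 3"
  \<comment> \<open>The entries put the trapped root in the monotone range, give 11/x^2 \<le> 11
    beyond \<open>R\<close>, and make c R exceed 11 (C0 + 1).\<close>
  define R where "R = max hi (max 1 (11 * (C0 + 1) / c + 1))"
  \<comment> \<open>Half the minimum of the Gaussian limit on [0, R]: a uniform error below
    \<open>m\<close> still leaves M_\<nu> \<ge> \<open>m\<close>. The next choice gives R \<epsilon>
    = m/2.\<close>
  define m where "m = exp (- (R\<^sup>2 / 4)) / sqrt pi / 2"
  define \<epsilon> where "\<epsilon> = m / (2 * R)"
  have lo: "0 < lo" "lo < x0" "x0 - e < lo" and hi: "x0 < hi" "hi < x0 + e"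
    using x0 \<open>0 < e\<close> by (auto simp: lo_def hi_def less_max_iff_disj)
  have C0: "0 < C0"
    unfolding C0_def using x0 by (rule Mainardi_ratio_half_pos)
  have c: "0 < c"
    unfolding c_def using Mainardi_cdf_pos[of "1/2" 1] by (simp add: Mainardi_half)
  have R: "hi \<le> R" "1 \<le> R" "11 * (C0 + 1) / c < R" "0 < R"
    by (auto simp: R_def less_max_iff_disj)
  then have R': "11 * (C0 + 1) < c * R"
    using c by (simp add: field_simps)
  have "11 < c * R"
    using R' C0 by simp
  then have R'': "11 / R < c"
    using R by (simp add: field_simps)
  have m: "0 < m"
    by (simp add: m_def)
  have \<epsilon>: "0 < \<epsilon>" "R * \<epsilon> < m"
    using m R by (auto simp: \<epsilon>_def)
  have "Mainardi_cdf (1/2) 1 \<le> Mainardi_cdf (1/2) R"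
    using R DERIV_Mainardi_cdf[of "1/2"]
    by (intro DERIV_nonneg_imp_nondecreasing[of 1 R "Mainardi_cdf (1/2)"])
      (auto simp: Mainardi_half intro!: exI)
  then have cdf_R: "2 * c < Mainardi_cdf (1/2) R"
    using c by (simp add: c_def)
  have "\<forall>\<^sub>F \<nu> in at_left (1/2). 2 * c < Mainardi_cdf \<nu> R"
    using cdf_R eventually_at_left_half
    by (intro order_tendstoD(1)[OF tendsto_Mainardi_cdf[OF tendsto_const tendsto_half_at_left]])
      (auto elim: eventually_mono)
  moreover have "\<forall>\<^sub>F \<nu> in at_left (1/2). C \<nu> < C0 + 1" "\<forall>\<^sub>F \<nu> in at_left (1/2). 0 < C \<nu>"
    using C C0 by (auto intro!: order_tendstoD[OF C] simp: C0_def)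
  moreover have "\<forall>\<^sub>F \<nu> in at_left (1/2). 0 < C \<nu> - Mainardi_ratio \<nu> lo"
    using Mainardi_ratio_half_less[of lo x0] lo
    by (intro order_tendstoD(1)[OF tendsto_diff[OF C tendsto_Mainardi_ratio]]) simp
  moreover have "\<forall>\<^sub>F \<nu> in at_left (1/2). C \<nu> - Mainardi_ratio \<nu> hi < 0"
    using Mainardi_ratio_half_less[of x0 hi] x0 hi
    by (intro order_tendstoD(2)[OF tendsto_diff[OF C tendsto_Mainardi_ratio]]) simp
  ultimately show ?thesis
    using eventually_at_left_half eventually_Wright_near_half[OF R(4) m, of 1]
      eventually_Wright_near_half[OF R(4) \<epsilon>(1), of 2]
  proof eventually_elim
    case (elim \<nu>)
    have \<nu>: "0 < \<nu>" "\<nu> \<le> 1/2" "1/4 \<le> \<nu>"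
      using elim by auto
    have M_ge: "m \<le> Mainardi \<nu> z" if "0 \<le> z" "z \<le> R" for z
    proof -
      have "2 * m \<le> Mainardi (1/2) z"
        using Mainardi_half_ge[OF that] by (simp add: m_def)
      moreover have "\<bar>Mainardi \<nu> z - Mainardi (1/2) z\<bar> < m"
        using bspec[OF elim(7), of z] that by (simp add: Mainardi_def)
      ultimately show ?thesis
        by linarith
    qed
    have W_ge: "- \<epsilon> \<le> Wright (- z) (- \<nu>) (1 - 2 * \<nu>)" if "0 \<le> z" "z \<le> R" for z
    proof -
      have "0 \<le> Wright (- z) (- (1/2)) 0"
        using that Wright_half_0[of z] by (simp add: Mainardi_half)
      moreover have "\<bar>Wright (- z) (- \<nu>) (1 - 2 * \<nu>) - Wright (- z) (- (1/2)) 0\<bar> < \<epsilon>"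
        using bspec[OF elim(8), of z] that by simp
      ultimately show ?thesis
        by linarith
    qed
    have less: "Mainardi_ratio \<nu> x < Mainardi_ratio \<nu> y" if "0 < x" "x < y" "y \<le> R" for x y
      using \<nu>(1,2) M_ge m W_ge less_imp_le[OF \<epsilon>(1)] \<epsilon>(2) that by (rule Mainardi_ratio_less)
    have "continuous_on {lo..hi} (Mainardi_ratio \<nu>)"
    proof (intro continuous_at_imp_continuous_on ballI)
      fix x assume "x \<in> {lo..hi}"
      then have "Mainardi \<nu> x \<noteq> 0"
        using M_ge[of x] m lo R by auto
      then show "isCont (Mainardi_ratio \<nu>) x"
        using DERIV_isCont[OF DERIV_Mainardi_ratio[OF \<nu>(1,2)]] by blast
    qed
    then obtain y where y: "lo \<le> y" "y \<le> hi" "Mainardi_ratio \<nu> y = C \<nu>"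
      using IVT'[of "Mainardi_ratio \<nu>" lo "C \<nu>" hi] elim lo hi by auto
    have "x = y" if x: "0 < x" "Mainardi_ratio \<nu> x = C \<nu>" for x
    proof (cases "x \<le> R")
      case True
      then show ?thesis
        using less[of x y] less[of y x] x y lo R by (cases x y rule: linorder_cases) auto
    next
      case False
      then have "R < x" by simp
      have "c \<le> Mainardi_cdf \<nu> R - 11 / R"
        using elim(1) R'' by simp
      also have "\<dots> \<le> Mainardi_cdf \<nu> x"
        using \<nu> R \<open>R < x\<close> by (intro Mainardi_cdf_ge) auto
      finally have cdf: "c \<le> Mainardi_cdf \<nu> x" .
      have M: "0 < Mainardi \<nu> x"
      \<comment> \<open>The case M_\<nu>(x) = 0 is included: division by zero gives ratio 0, which
        differs from the positive target as well.\<close>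
      proof (rule ccontr)
        assume "\<not> 0 < Mainardi \<nu> x"
        then have "Mainardi_ratio \<nu> x \<le> 0"
          unfolding Mainardi_ratio_def using cdf c x(1)
          by (intro divide_nonneg_nonpos mult_nonneg_nonneg) auto
        then show False
          using x(2) elim by simp
      qed
      have "Mainardi \<nu> x \<le> 11 / x\<^sup>2"
        using abs_Mainardi_le[OF \<nu>(3,2) x(1)] by simp
      also have "\<dots> \<le> 11 / 1"
        using R \<open>R < x\<close> by (intro divide_left_mono) (auto intro: one_le_power)
      finally have "Mainardi \<nu> x * (C0 + 1) \<le> 11 * (C0 + 1)"
        using C0 by (intro mult_right_mono) auto
      also have "\<dots> < c * R"
        by (rule R')
      also have "\<dots> \<le> Mainardi_cdf \<nu> x * x"
        using cdf c R \<open>R < x\<close> by (intro mult_mono) auto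
      finally have "C0 + 1 < Mainardi_ratio \<nu> x"
        using M by (simp add: Mainardi_ratio_def field_simps)
      then show ?thesis
        using x(2) elim by simp
    qed
    then show ?case
      using y lo hi by (intro exI[of _ y]) auto
  qed
qed

section \<open>Return to the data of the free boundary problem\<close>

lemma mu4_root:
  assumes "0 < c" "0 < l" "Tm < T0"
  shows "0 < mu4 c l T0 Tm"
    "mu4 c l T0 Tm * exp ((mu4 c l T0 Tm)\<^sup>2) * erf (mu4 c l T0 Tm) = c * (T0 - Tm) / (l * sqrt pi)"
proof -
  have "0 < c * (T0 - Tm) / (l * sqrt pi)"
    using assms by simp
  from theI'[OF ex1_x_exp_erf[OF this], folded mu4_def]
  show "0 < mu4 c l T0 Tm"
    "mu4 c l T0 Tm * exp ((mu4 c l T0 Tm)\<^sup>2) * erf (mu4 c l T0 Tm) = c * (T0 - Tm) / (l * sqrt pi)"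
    by auto
qed

lemma filterlim_half_at_left: "filterlim (\<lambda>\<alpha>. \<alpha> / 2) (at_left (1/2)) (at_left (1::real))"
  unfolding filterlim_at
  by (auto intro!: tendsto_eq_intros simp: eventually_at_filter)

text \<open>The root lemma with \<nu> = \<alpha>/2 and \<open>x0\<close> = 2\<mu>. Its uniqueness
  part lets the definite description in \<open>xi4\<close> be evaluated for \<alpha> near 1.\<close>

lemma tendsto_xi4:
  assumes "0 < c" "0 < l" "Tm < T0"
  shows "(xi4 c l T0 Tm \<longlongrightarrow> 2 * mu4 c l T0 Tm) (at_left 1)"
proof (rule tendstoI)
  fix e :: real assume "0 < e"
  define \<mu> where "\<mu> = mu4 c l T0 Tm"
  define C where "C \<nu> = c * (T0 - Tm) * Gamma (1 - \<nu>) / (l * Gamma (1 + \<nu>))" for \<nu>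
  have \<mu>: "0 < \<mu>" "\<mu> * exp (\<mu>\<^sup>2) * erf \<mu> = c * (T0 - Tm) / (l * sqrt pi)"
    unfolding \<mu>_def using assms by (rule mu4_root)+
  have "(1/2::real) \<notin> \<int>\<^sub>\<le>\<^sub>0"
    by (auto dest: nonpos_Ints_nonpos)
  then have Gamma_3_2: "Gamma (3/2 :: real) = sqrt pi / 2"
    using Gamma_plus1[of "1/2::real"] by (simp add: Gamma_one_half_real)
  have "(C \<longlongrightarrow> c * (T0 - Tm) * Gamma (1 - 1/2) / (l * Gamma (1 + 1/2))) (at_left (1/2))"
    unfolding C_def using assms
    by (intro tendsto_intros tendsto_Gamma tendsto_half_at_left)
      (auto simp: Gamma_3_2 elim!: nonpos_Ints_cases)
  \<comment> \<open>Since Gamma(1/2) = 2 Gamma(3/2), both sides equal 2c(T0 - Tm)/l; for the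
    right-hand side this is the equation of \<mu>.\<close>
  also have "c * (T0 - Tm) * Gamma (1 - 1/2) / (l * Gamma (1 + 1/2)) = Mainardi_ratio (1/2) (2 * \<mu>)"
    using \<mu>(1) assms by (simp add: Mainardi_ratio_half \<mu>(2) Gamma_3_2 Gamma_one_half_real)
  finally have "\<forall>\<^sub>F \<nu> in at_left (1/2). \<exists>y. 0 < y \<and> \<bar>y - 2 * \<mu>\<bar> < e \<and> Mainardi_ratio \<nu> y = C \<nu> \<and>
    (\<forall>x. 0 < x \<and> Mainardi_ratio \<nu> x = C \<nu> \<longrightarrow> x = y)"
    using \<mu>(1) \<open>0 < e\<close> by (intro Mainardi_ratio_root_near_half) auto
  from eventually_compose_filterlim[OF this filterlim_half_at_left]
  show "\<forall>\<^sub>F \<alpha> in at_left 1. dist (xi4 c l T0 Tm \<alpha>) (2 * mu4 c l T0 Tm) < e"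
  proof eventually_elim
    case (elim \<alpha>)
    then obtain y where y: "0 < y" "\<bar>y - 2 * \<mu>\<bar> < e" "Mainardi_ratio (\<alpha> / 2) y = C (\<alpha> / 2)"
      "\<And>x. 0 < x \<Longrightarrow> Mainardi_ratio (\<alpha> / 2) x = C (\<alpha> / 2) \<Longrightarrow> x = y"
      by blast
    have "xi4 c l T0 Tm \<alpha> = (THE x. 0 < x \<and> Mainardi_ratio (\<alpha> / 2) x = C (\<alpha> / 2))"
      by (simp add: xi4_def Mainardi_ratio_def Mainardi_cdf_def C_def)
    also have "\<dots> = y"
      by (rule the_equality) (use y(1,3) in simp, blast intro: y(4))
    finally show ?case
      using y(2) by (simp add: dist_real_def \<mu>_def)
  qed
qed

theorem theorem9:
  fixes k c l T0 Tm q0 :: real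
  assumes "0 < k" "0 < c" "0 < l" "Tm < T0" "0 < q0"
  shows "((\<lambda>\<alpha>. rho4 k c l T0 Tm q0 \<alpha>) \<longlongrightarrow> rho4_1 k c l T0 Tm q0) (at_left 1) \<and>
    (\<forall>t>0. ((\<lambda>\<alpha>. s4 k c l T0 Tm q0 \<alpha> t) \<longlongrightarrow> s4_1 k c l T0 Tm q0 t) (at_left 1)) \<and>
    (\<forall>t>0. \<forall>x\<ge>0. ((\<lambda>\<alpha>. T4 k c l T0 Tm q0 \<alpha> x t) \<longlongrightarrow> T4_1 k c l T0 Tm q0 x t) (at_left 1))"
proof -
  define \<mu> where "\<mu> = mu4 c l T0 Tm"
  define \<xi> where "\<xi> = xi4 c l T0 Tm"
  define L where "L = lam4_1 k c l T0 Tm q0"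
  have \<mu>: "0 < \<mu>"
    unfolding \<mu>_def using assms by (intro mu4_root)
  then have erf: "0 < erf \<mu>"
    by (rule erf_pos)
  have L: "0 < L"
    using assms erf by (simp add: L_def lam4_1_def flip: \<mu>_def)
  have half: "((\<lambda>\<alpha>. \<alpha> / 2) \<longlongrightarrow> 1/2) (at_left (1::real))"
    by (intro tendsto_intros) auto
  have half_le: "\<forall>\<^sub>F \<alpha> in at_left (1::real). \<alpha> / 2 \<le> 1/2"
    by (simp add: eventually_at_filter)
  \<comment> \<open>Stated for a moving argument so that it serves both \<xi> and the similarity
    variable in \<open>T4\<close>, where \<lambda> also depends on \<alpha>.\<close>
  have cdf: "((\<lambda>\<alpha>. 1 - Wright (- \<zeta> \<alpha>) (- \<alpha> / 2) 1) \<longlongrightarrow> erf x) (at_left 1)"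
    if "(\<zeta> \<longlongrightarrow> 2 * x) (at_left 1)" "0 \<le> x" for \<zeta> x
    using tendsto_Mainardi_cdf[OF that(1) half half_le] Mainardi_cdf_half[OF that(2)]
    by (simp add: Mainardi_cdf_def)
  have \<xi>: "(\<xi> \<longlongrightarrow> 2 * \<mu>) (at_left 1)"
    unfolding \<xi>_def \<mu>_def using assms by (intro tendsto_xi4)
  have cdf_\<xi>: "((\<lambda>\<alpha>. 1 - Wright (- \<xi> \<alpha>) (- \<alpha> / 2) 1) \<longlongrightarrow> erf \<mu>) (at_left 1)"
    using \<xi> \<mu> by (intro cdf) auto
  have "((\<lambda>\<alpha>. Gamma (1 - \<alpha> / 2)) \<longlongrightarrow> Gamma (1 - 1/2)) (at_left (1::real))"
    by (intro tendsto_Gamma tendsto_intros half) (auto elim!: nonpos_Ints_cases)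
  then have G: "((\<lambda>\<alpha>. Gamma (1 - \<alpha> / 2)) \<longlongrightarrow> sqrt pi) (at_left (1::real))"
    by (simp add: Gamma_one_half_real)
  have "((\<lambda>\<alpha>. lam4 k c l T0 Tm q0 \<alpha>) \<longlongrightarrow> k * (T0 - Tm) / (q0 * sqrt pi * erf \<mu>)) (at_left 1)"
    unfolding lam4_def \<xi>_def[symmetric] using assms erf by (intro tendsto_intros G cdf_\<xi>) auto
  then have lam: "((\<lambda>\<alpha>. lam4 k c l T0 Tm q0 \<alpha>) \<longlongrightarrow> L) (at_left 1)"
    by (simp add: L_def lam4_1_def \<mu>_def)
  have powr: "((\<lambda>\<alpha>. t powr (\<alpha> / 2)) \<longlongrightarrow> sqrt t) (at_left 1)" if "0 < t" for t :: real
    using that tendsto_powr[OF tendsto_const half, of t] by (simp add: powr_half_sqrt)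
  have "((\<lambda>\<alpha>. rho4 k c l T0 Tm q0 \<alpha>) \<longlongrightarrow>
    q0\<^sup>2 * (sqrt pi)\<^sup>2 / (k * c * (T0 - Tm)\<^sup>2) * (erf \<mu>)\<^sup>2) (at_left 1)"
    unfolding rho4_def \<xi>_def[symmetric] using assms by (intro tendsto_intros G cdf_\<xi>) auto
  then have "((\<lambda>\<alpha>. rho4 k c l T0 Tm q0 \<alpha>) \<longlongrightarrow> rho4_1 k c l T0 Tm q0) (at_left 1)"
    by (simp add: rho4_1_def \<mu>_def mult.commute)
  moreover have "((\<lambda>\<alpha>. s4 k c l T0 Tm q0 \<alpha> t) \<longlongrightarrow> s4_1 k c l T0 Tm q0 t) (at_left 1)" if "0 < t" for t
  proof -
    have "((\<lambda>\<alpha>. s4 k c l T0 Tm q0 \<alpha> t) \<longlongrightarrow> L * (2 * \<mu>) * sqrt t) (at_left 1)"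
      unfolding s4_def \<xi>_def[symmetric] using that by (intro tendsto_intros lam \<xi> powr)
    then show ?thesis
      by (simp add: s4_1_def L_def \<mu>_def mult_ac)
  qed
  moreover have "((\<lambda>\<alpha>. T4 k c l T0 Tm q0 \<alpha> x t) \<longlongrightarrow> T4_1 k c l T0 Tm q0 x t) (at_left 1)"
    if "0 < t" "0 \<le> x" for x t
  proof -
    have "((\<lambda>\<alpha>. x / (lam4 k c l T0 Tm q0 \<alpha> * t powr (\<alpha> / 2))) \<longlongrightarrow> x / (L * sqrt t)) (at_left 1)"
      using that L by (intro tendsto_intros lam powr) auto
    \<comment> \<open>The limit is written as twice the argument of \<open>erf\<close>, the form
      that \<open>cdf\<close> expects.\<close>
    then have *: "((\<lambda>\<alpha>. x / (lam4 k c l T0 Tm q0 \<alpha> * t powr (\<alpha> / 2))) \<longlongrightarrow> 2 * (x / (2 * L * sqrt t))) (at_left 1)"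
      by simp
    show ?thesis
      unfolding T4_def T4_1_def \<xi>_def[symmetric] \<mu>_def[symmetric] L_def[symmetric]
      using erf that L by (intro tendsto_intros cdf_\<xi> cdf *) auto
  qed
  ultimately show ?thesis
    by blast
qed

end
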